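(* Let $(\Omega,\mathcal A,P)$ be a probability space and let $A,B,C\in\mathcal A$ with $A\subset B$ and such that the events $A$, $B\backslash A$ and $C$ all have positive probability. Then $RB(A\,|\,C)>RB(B\,|\,C)$ if and only if $RB(A\,|\,C)>RB(B\backslash A\,|\,C)$.
   Context: For events $D,C$ with $P(D)>0$ and $P(C)>0$, the relative belief ratio of $D$ given $C$ is $RB(D\,|\,C)=P(D\,|\,C)/P(D)$. *)

theory Defs
  imports "HOL-Probability.Probability"
begin

(* Relative belief ratio RB(D | C) of events D and C of M. It carries the intended meaning only if
   D and C have positive probability; division by zero makes it 0 otherwise. *)
definition RB :: "'a measure \<Rightarrow> 'a set \<Rightarrow> 'a set \<Rightarrow> real" where
  "RB M D C = \<P>(\<omega> in M. \<omega> \<in> D \<bar> \<omega> \<in> C) / measure M D"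

end

(* RB(B | C) is the mediant of RB(A | C) and RB(B - A | C) with weights P(A) and P(B - A), hence lies
   between them. *)
theory Submission
  imports Defs
begin

text \<open>Since \<open>B\<close> is the disjoint union of \<open>A\<close> and
  \<open>B - A\<close>, both P(B) and P(B \<inter> C) split as sums. Up to the common factor 1/P(C),
  the three ratios are x/a, y/b and (x+y)/(a+b), and \<open>mediant_less_iff\<close> compares
  them.\<close>

lemma (in prob_space) RB_eq:
  assumes "D \<in> events" "C \<in> events"
  shows "RB M D C = prob (D \<inter> C) / prob D / prob C"
proof -
  have "{\<omega> \<in> space M. \<omega> \<in> D \<and> \<omega> \<in> C} = D \<inter> C" "{\<omega> \<in> space M. \<omega> \<in> C} = C"
    using assms sets.sets_into_space by blast+
  then show ?thesis
    by (simp add: RB_def cond_prob_def mult.commute)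
qed

text \<open>Clearing the positive denominators, the term x * a cancels and both inequalities become
  y * a < x * b.\<close>

lemma mediant_less_iff:
  fixes x y a b :: real
  assumes "a > 0" "b > 0"
  shows "(x + y) / (a + b) < x / a \<longleftrightarrow> y / b < x / a"
proof -
  have "(x + y) / (a + b) < x / a \<longleftrightarrow> (x + y) * a < x * (a + b)"
    using assms by (simp add: pos_divide_less_eq pos_less_divide_eq)
  also have "\<dots> \<longleftrightarrow> y * a < x * b"
    by (simp add: algebra_simps)
  also have "\<dots> \<longleftrightarrow> y / b < x / a"
    using assms by (simp add: pos_divide_less_eq pos_less_divide_eq)
  finally show ?thesis .
qed

theorem proposition10:
  fixes M :: "'a measure" and A B C :: "'a set"
  assumes "prob_space M"
    and "A \<in> sets M" and "B \<in> sets M" and "C \<in> sets M"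
    and "A \<subseteq> B"
    and "measure M A > 0" and "measure M (B - A) > 0" and "measure M C > 0"
  shows "RB M A C > RB M B C \<longleftrightarrow> RB M A C > RB M (B - A) C"
proof -
  interpret prob_space M by fact
  have "prob B = prob A + prob (B - A)"
    using assms finite_measure_Diff[of B A] by simp
  moreover have "prob (B \<inter> C) = prob (A \<inter> C) + prob ((B - A) \<inter> C)"
    using assms finite_measure_Union[of "A \<inter> C" "(B - A) \<inter> C"]
    by (simp add: Int_Un_distrib2[symmetric] Un_absorb1 disjoint_iff)
  ultimately show ?thesis
    \<comment> \<open>Keeping the quotients nested leaves \<open>prob C\<close> as the outermost
      divisor on both sides, where \<open>divide_less_cancel\<close> removes it.\<close>
    using assms by (simp add: RB_eq divide_less_cancel mediant_less_iff del: divide_divide_eq_left)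
qed

end
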